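(* Let $k\ge1$, $\pi\in S_k$, $i\in[k]$, and let $p=(\pi,R)$ with $R=[k]\times([k]\setminus\{i\})$ (all rows of boxes shaded except row $i$, which is fully unshaded). Then for every $n\ge k$, \[ s_n^+(p)=\frac{n!}{k!}\qquad\text{and}\qquad \frac{s_n^+(p)}{n!}=\frac1{k!}. \]
   Context: For $n\ge1$, $S_n$ is the set of permutations of $\{1,\dots,n\}$ in one-line notation $\tau=\tau_1\cdots\tau_n$. For an integer $k\ge0$ write $[k]=\{0,1,\dots,k\}$. A mesh pattern of length $k$ is a pair $(\pi,R)$ with $\pi\in S_k$ and $R\subseteq[k]\times[k]$; the elements $(x,y)\in R$ are the shaded boxes (box $(x,y)$ is the unit square with south-west corner $(x,y)$ in the plot of the points $(i,\pi_i)$); row $y$ of boxes is $[k]\times\{y\}$ and column $x$ is $\{x\}\times[k]$. An occurrence of $(\pi,R)$ in $\tau\in S_n$ is a choice of positions $i_1<\dots<i_k$ such that $\tau_{i_a}<\tau_{i_b}$ iff $\pi_a<\pi_b$ for all $a,b$, and such that for every $(x,y)\in R$ there is no index $m$ with $i_x<m<i_{x+1}$ and $v_y<\tau_m<v_{y+1}$, where $i_0=0$, $i_{k+1}=n+1$, $v_0=0$, $v_{k+1}=n+1$, and for $1\le y\le k$, $v_y$ is the $y$-th smallest of the values $\tau_{i_1},\dots,\tau_{i_k}$. A permutation contains a mesh pattern if it has at least one occurrence of it, and $s_n^+(p)$ denotes the number of permutations in $S_n$ containing $p$. *)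

theory Defs
  imports Complex_Main "HOL-Combinatorics.Permutations"
begin

text \<open>
  A permutation of \<open>{1..n}\<close> with one-line notation \<open>\<tau>\<^sub>1 \<dots> \<tau>\<^sub>n\<close> is a function \<open>\<tau>\<close> with
  \<open>\<tau> permutes {1..n}\<close>; its \<open>j\<close>-th letter is \<open>\<tau> j\<close>.  Such a function does not determine \<open>n\<close>
  (it may fix \<open>n\<close>), so the length \<open>k\<close> of a pattern and the length \<open>n\<close> of a permutation are
  passed explicitly.  A pair \<open>(\<pi>, R)\<close> is a mesh pattern of length \<open>k\<close> when
  \<open>\<pi> permutes {1..k}\<close> and \<open>R \<subseteq> {0..k} \<times> {0..k}\<close>.
\<close>

type_synonym mesh_pattern = "(nat \<Rightarrow> nat) \<times> (nat \<times> nat) set"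

text \<open>The conventions \<open>i\<^sub>0 = v\<^sub>0 = 0\<close> and \<open>i\<^sub>k\<^sub>+\<^sub>1 = v\<^sub>k\<^sub>+\<^sub>1 = n + 1\<close>.\<close>

definition bordered :: "nat \<Rightarrow> nat \<Rightarrow> (nat \<Rightarrow> nat) \<Rightarrow> nat \<Rightarrow> nat" where
  "bordered k n f j = (if j = 0 then 0 else if j = k + 1 then n + 1 else f j)"

definition kth_smallest :: "nat set \<Rightarrow> nat \<Rightarrow> nat" where
  "kth_smallest A y = sorted_list_of_set A ! (y - 1)"

text \<open>The positions of an occurrence are \<open>pos 1 < \<dots> < pos k\<close>; \<open>pos\<close> is irrelevant
  outside \<open>{1..k}\<close>.\<close>

definition mesh_occurrence ::
  "nat \<Rightarrow> mesh_pattern \<Rightarrow> nat \<Rightarrow> (nat \<Rightarrow> nat) \<Rightarrow> (nat \<Rightarrow> nat) \<Rightarrow> bool" where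
  "mesh_occurrence k p n \<tau> pos \<longleftrightarrow>
     pos ` {1..k} \<subseteq> {1..n} \<and> strict_mono_on {1..k} pos \<and>
     (\<forall>a\<in>{1..k}. \<forall>b\<in>{1..k}. \<tau> (pos a) < \<tau> (pos b) \<longleftrightarrow> fst p a < fst p b) \<and>
     (let I = bordered k n pos;
          v = bordered k n (kth_smallest (\<tau> ` pos ` {1..k}))
      in \<forall>(x, y)\<in>snd p.
           \<not> (\<exists>m. I x < m \<and> m < I (x + 1) \<and> v y < \<tau> m \<and> \<tau> m < v (y + 1)))"

definition contains_mesh :: "nat \<Rightarrow> mesh_pattern \<Rightarrow> nat \<Rightarrow> (nat \<Rightarrow> nat) \<Rightarrow> bool" where
  "contains_mesh k p n \<tau> \<longleftrightarrow> (\<exists>pos. mesh_occurrence k p n \<tau> pos)"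

definition s_plus :: "nat \<Rightarrow> mesh_pattern \<Rightarrow> nat \<Rightarrow> nat" where
  "s_plus k p n = card {\<tau>. \<tau> permutes {1..n} \<and> contains_mesh k p n \<tau>}"

end

theory Submission
  imports Defs
begin

text \<open>
  A fully shaded row \<open>y\<close> forces the values \<open>v\<^sub>y\<close> and \<open>v\<^sub>y\<^sub>+\<^sub>1\<close> to be consecutive, since every
  value strictly between them would be taken in some column of that row. With all rows but row
  \<open>i\<close> shaded, an occurrence can only use the \<open>i\<close> smallest and the \<open>k - i\<close> largest values, so
  \<open>\<tau>\<close> contains the pattern iff these \<open>k\<close> values appear in \<open>\<tau>\<close> in the order prescribed by \<open>\<pi>\<close>.
  Permuting these values among themselves shows that each of the \<open>k!\<close> orders is equally frequent.
\<close>

section \<open>Increasing enumerations of finite sets of naturals\<close>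

lemma kth_smallest_strict_mono_on:
  assumes "strict_mono_on {1..k} f" "j \<in> {1..k}"
  shows "kth_smallest (f ` {1..k}) j = f j"
proof -
  have "sorted_wrt (<) (map f [1..<Suc k])"
    using assms(1) by (auto simp: sorted_wrt_map sorted_wrt_iff_nth_less strict_mono_on_def
        simp del: upt_Suc)
  moreover have set: "set (map f [1..<Suc k]) = f ` {1..k}"
    by (auto simp del: upt_Suc)
  ultimately have "sorted_list_of_set (f ` {1..k}) = map f [1..<Suc k]"
    by (metis sorted_list_of_set.idem_if_sorted_distinct strict_sorted_iff map_ident subset_UNIV)
  then show ?thesis
    using assms(2) by (auto simp: kth_smallest_def simp del: upt_Suc)
qed

lemma strict_mono_on_kth_smallest:
  assumes "finite A" "card A = k"
  shows "strict_mono_on {1..k} (kth_smallest A)" "kth_smallest A ` {1..k} = A"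
proof -
  show "strict_mono_on {1..k} (kth_smallest A)"
  proof (rule strict_mono_onI)
    fix r s assume "r \<in> {1..k}" "s \<in> {1..k}" "r < s"
    then show "kth_smallest A r < kth_smallest A s"
      unfolding kth_smallest_def using assms
      by (intro sorted_wrt_nth_less[OF strict_sorted_list_of_set]) auto
  qed
  \<comment> \<open>\<open>kth_smallest\<close> counts from 1 and list positions from 0, hence the
    shift to \<open>{0..<k}\<close>.\<close>
  have "kth_smallest A ` {1..k} = (!) (sorted_list_of_set A) ` {0..<k}"
  proof (intro subset_antisym image_subsetI)
    fix x assume "x \<in> {0..<k}"
    then show "sorted_list_of_set A ! x \<in> kth_smallest A ` {1..k}"
      by (intro image_eqI[of _ _ "Suc x"]) (auto simp: kth_smallest_def)
  qed (auto simp: kth_smallest_def)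
  also have "\<dots> = A"
    using assms nth_image[of k "sorted_list_of_set A"] by (simp add: atLeast0LessThan)
  finally show "kth_smallest A ` {1..k} = A" .
qed

text \<open>This is the sorting permutation of \<open>f\<close>. It exists by pulling the increasing
  enumeration of the image back along \<open>f\<close>, and it is unique because a finite set has
  only one increasing enumeration.\<close>

lemma ex1_permutes_strict_mono_on:
  fixes f :: "nat \<Rightarrow> nat"
  assumes "inj_on f {1..k}"
  shows "\<exists>!\<pi>. \<pi> permutes {1..k} \<and> strict_mono_on {1..k} (f \<circ> \<pi>)"
proof (rule ex_ex1I)
  define g where "g = kth_smallest (f ` {1..k})"
  have card: "card (f ` {1..k}) = k"
    using assms by (simp add: card_image)
  have g: "strict_mono_on {1..k} g" "g ` {1..k} = f ` {1..k}"
    unfolding g_def using card by (intro strict_mono_on_kth_smallest; simp)+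
  \<comment> \<open>\<open>restrict_id\<close> makes the map the identity off \<open>{1..k}\<close>,
    as \<open>permutes\<close> demands.\<close>
  define \<pi> where "\<pi> = restrict_id (inv_into {1..k} f \<circ> g) {1..k}"
  have "bij_betw g {1..k} (f ` {1..k})"
    using g by (simp add: bij_betw_def strict_mono_on_imp_inj_on)
  moreover have "bij_betw (inv_into {1..k} f) (f ` {1..k}) {1..k}"
    using assms by (simp add: bij_betw_inv_into inj_on_imp_bij_betw)
  ultimately have "bij_betw (inv_into {1..k} f \<circ> g) {1..k} {1..k}"
    by (rule bij_betw_trans)
  then have "\<pi> permutes {1..k}"
    unfolding \<pi>_def
    by (intro bij_imp_permutes bij_betw_restrict_id) (auto simp: restrict_id_def)
  moreover have "f (\<pi> j) = g j" if "j \<in> {1..k}" for j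
  proof -
    have "g j \<in> f ` {1..k}" using g(2) that by blast
    then show ?thesis using that by (simp add: \<pi>_def restrict_id_def f_inv_into_f)
  qed
  ultimately show "\<exists>\<pi>. \<pi> permutes {1..k} \<and> strict_mono_on {1..k} (f \<circ> \<pi>)"
    using g(1) by (intro exI[of _ \<pi>]) (auto simp: strict_mono_on_def)
next
  fix \<pi> \<rho>
  assume \<pi>: "\<pi> permutes {1..k} \<and> strict_mono_on {1..k} (f \<circ> \<pi>)"
    and \<rho>: "\<rho> permutes {1..k} \<and> strict_mono_on {1..k} (f \<circ> \<rho>)"
  have "(f \<circ> \<pi>) ` {1..k} = (f \<circ> \<rho>) ` {1..k}"
    using \<pi> \<rho> by (simp only: image_comp[symmetric] permutes_image)
  then have "f (\<pi> j) = f (\<rho> j)" if "j \<in> {1..k}" for j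
    using kth_smallest_strict_mono_on[of k "f \<circ> \<pi>" j]
      kth_smallest_strict_mono_on[of k "f \<circ> \<rho>" j] \<pi> \<rho> that by simp
  moreover have "\<pi> j \<in> {1..k}" "\<rho> j \<in> {1..k}" if "j \<in> {1..k}" for j
    using permutes_in_image[of \<pi>] permutes_in_image[of \<rho>] \<pi> \<rho> that by blast+
  ultimately have "\<pi> j = \<rho> j" if "j \<in> {1..k}" for j
    using assms that by (meson inj_onD)
  moreover have "\<pi> j = \<rho> j" if "j \<notin> {1..k}" for j
    using \<pi> \<rho> that by (metis permutes_not_in)
  ultimately show "\<pi> = \<rho>" by blast
qed

section \<open>Equidistribution of the orders in which prescribed values appear\<close>

lemma card_permutes_strict_mono_on_inv:
  fixes w :: "nat \<Rightarrow> nat"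
  assumes w: "inj_on w {1..k}" "w ` {1..k} \<subseteq> {1..n}" and \<pi>: "\<pi> permutes {1..k}"
  shows "fact k * card {\<tau>. \<tau> permutes {1..n} \<and> strict_mono_on {1..k} (inv \<tau> \<circ> w \<circ> \<pi>)} = fact n"
proof -
  define A where
    "A \<pi> = {\<tau>. \<tau> permutes {1..n} \<and> strict_mono_on {1..k} (inv \<tau> \<circ> w \<circ> \<pi>)}" for \<pi>
  have fin: "finite (A \<pi>)" for \<pi>
    unfolding A_def by (rule finite_subset[OF _ finite_permutations[of "{1..n}"]]) auto
  \<comment> \<open>Since \<open>\<pi>\<close> and \<open>\<rho>\<close> are arbitrary here, the
    inequality in both directions gives equal cardinalities.\<close>
  have le: "card (A \<pi>) \<le> card (A \<rho>)"
    if \<pi>: "\<pi> permutes {1..k}" and \<rho>: "\<rho> permutes {1..k}" for \<pi> \<rho>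
  proof -
    \<comment> \<open>\<open>\<phi>\<close> renames the value \<open>w (\<pi> j)\<close> to
      \<open>w (\<rho> j)\<close> and fixes all values outside the range of \<open>w\<close> on
      \<open>{1..k}\<close>. Composing on the left keeps positions, so \<open>w (\<rho> j)\<close>
      lands where \<open>\<tau>\<close> had \<open>w (\<pi> j)\<close>.\<close>
    define \<phi> where "\<phi> = map_permutation {1..k} w (\<rho> \<circ> inv \<pi>)"
    have "\<phi> permutes w ` {1..k}"
      unfolding \<phi>_def using \<pi> \<rho> w(1)
      by (intro map_permutation_permutes permutes_compose permutes_inv inj_on_imp_bij_betw)
    then have \<phi>: "\<phi> permutes {1..n}"
      using w(2) permutes_subset by blast
    have *: "inv \<phi> (w (\<rho> j)) = w (\<pi> j)" if "j \<in> {1..k}" for j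
    proof -
      have "\<pi> j \<in> {1..k}" using permutes_in_image[OF \<pi>] that by blast
      then have "\<phi> (w (\<pi> j)) = w (\<rho> j)"
        unfolding \<phi>_def using w(1) \<pi> by (simp add: map_permutation_apply permutes_inverses)
      then show ?thesis using \<phi> by (simp add: permutes_inv_eq)
    qed
    have "(\<lambda>\<tau>. \<phi> \<circ> \<tau>) ` A \<pi> \<subseteq> A \<rho>"
    proof (rule image_subsetI)
      fix \<tau> assume "\<tau> \<in> A \<pi>"
      then have \<tau>: "\<tau> permutes {1..n}" "strict_mono_on {1..k} (inv \<tau> \<circ> w \<circ> \<pi>)"
        by (auto simp: A_def)
      have "inv (\<phi> \<circ> \<tau>) = inv \<tau> \<circ> inv \<phi>"
        using \<phi> \<tau>(1) by (intro o_inv_distrib) (auto intro: permutes_bij)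
      then have "strict_mono_on {1..k} (inv (\<phi> \<circ> \<tau>) \<circ> w \<circ> \<rho>)"
        using \<tau>(2) * by (simp add: strict_mono_on_def)
      then show "\<phi> \<circ> \<tau> \<in> A \<rho>"
        using \<phi> \<tau>(1) by (simp add: A_def permutes_compose)
    qed
    moreover have "inj_on (\<lambda>\<tau>. \<phi> \<circ> \<tau>) (A \<pi>)"
      using permutes_inj[OF \<phi>] by (intro inj_onI) (simp add: fun_eq_iff inj_eq)
    ultimately show ?thesis
      using fin card_inj_on_le by blast
  qed
  \<comment> \<open>Sorting the positions of the prescribed values puts each \<open>\<tau>\<close>
    in exactly one class \<open>A \<pi>\<close>, so the \<open>fact k\<close> classes partition the
    permutations of \<open>{1..n}\<close>.\<close>
  have ex1: "\<exists>!\<pi>. \<pi> permutes {1..k} \<and> strict_mono_on {1..k} (inv \<tau> \<circ> w \<circ> \<pi>)"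
    if "\<tau> permutes {1..n}" for \<tau>
    using w(1) permutes_inj[OF permutes_inv[OF that]]
    by (intro ex1_permutes_strict_mono_on comp_inj_on) (auto intro: inj_on_subset)
  have "fact n = card {\<tau>. \<tau> permutes {1..n}}"
    by (simp add: card_permutations)
  also have "{\<tau>. \<tau> permutes {1..n}} = (\<Union>\<rho>\<in>{\<rho>. \<rho> permutes {1..k}}. A \<rho>)"
    using ex1 unfolding A_def by blast
  also have "card \<dots> = (\<Sum>\<rho>\<in>{\<rho>. \<rho> permutes {1..k}}. card (A \<rho>))"
    using fin ex1 unfolding A_def by (intro card_UN_disjoint finite_permutations) auto
  also have "\<dots> = (\<Sum>\<rho>\<in>{\<rho>. \<rho> permutes {1..k}}. card (A \<pi>))"
    using le \<pi> by (intro sum.cong refl antisym) auto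
  also have "\<dots> = fact k * card (A \<pi>)"
    by (simp add: card_permutations)
  finally show ?thesis
    by (simp add: A_def)
qed

section \<open>Values forced by shaded rows\<close>

text \<open>If there were a gap, the value \<open>v y + 1\<close> would occur in
  \<open>\<tau>\<close> at an unchosen position, hence inside some box of row \<open>y\<close>. As
  \<open>v\<close> includes the borders, rows \<open>0\<close> and \<open>k\<close> are covered as
  well.\<close>

lemma shaded_row_consecutive_values:
  assumes \<tau>: "\<tau> permutes {1..n}" and pos: "pos ` {1..k} \<subseteq> {1..n}"
    and v: "v = bordered k n (kth_smallest (\<tau> ` pos ` {1..k}))"
    and mono: "strict_mono_on {0..k+1} v"
    and u: "\<And>a. a \<in> {1..k} \<Longrightarrow> \<exists>b\<in>{1..k}. \<tau> (pos a) = v b"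
    and y: "y \<le> k"
    and empty: "\<And>x m. x \<le> k \<Longrightarrow> bordered k n pos x < m \<Longrightarrow> m < bordered k n pos (x + 1) \<Longrightarrow>
      v y < \<tau> m \<Longrightarrow> \<tau> m < v (y + 1) \<Longrightarrow> False"
  shows "v (y + 1) = v y + 1"
proof (rule ccontr)
  assume "v (y + 1) \<noteq> v y + 1"
  moreover have "v y < v (y + 1)"
    using mono y by (auto simp: strict_mono_on_def)
  ultimately have lt: "v y + 1 < v (y + 1)" by auto
  have "v (k + 1) = n + 1" by (simp add: v bordered_def)
  moreover have "v (y + 1) \<le> v (k + 1)"
    using mono y by (cases "y = k") (auto simp: strict_mono_on_def intro: less_imp_le)
  \<comment> \<open>The upper border is \<open>n + 1\<close>, so a value strictly below
    \<open>v (y + 1)\<close> is at most \<open>n\<close> and is really taken by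
    \<open>\<tau>\<close>.\<close>
  ultimately have in_n: "v y + 1 \<in> {1..n}" using lt by auto
  define m where "m = inv \<tau> (v y + 1)"
  have \<tau>m: "\<tau> m = v y + 1"
    using \<tau> by (simp add: m_def permutes_inverses)
  have m: "m \<in> {1..n}"
    using \<tau> in_n \<tau>m by (metis permutes_in_image)
  have no_pos: "m \<noteq> pos a" if "a \<in> {1..k}" for a
  proof
    assume "m = pos a"
    then obtain b where b: "b \<in> {1..k}" "v b = v y + 1" using u[OF \<open>a \<in> {1..k}\<close>] \<tau>m by auto
    have "y < b \<longleftrightarrow> v y < v b" "b < y + 1 \<longleftrightarrow> v b < v (y + 1)"
      using b(1) y by (auto simp: strict_mono_on_less[OF mono])
    then show False using lt b(2) by auto
  qed
  let ?I = "bordered k n pos"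
  \<comment> \<open>\<open>x\<close> is the column of \<open>m\<close>, found from the last border
    to its left; the candidate \<open>0\<close> is available because the left border is
    \<open>0 < m\<close>.\<close>
  define x where "x = (GREATEST x. x \<le> k \<and> ?I x < m)"
  have x: "x \<le> k \<and> ?I x < m"
    unfolding x_def by (rule GreatestI_nat[of _ 0 k]) (use m in \<open>auto simp: bordered_def\<close>)
  have "m < ?I (x + 1)"
  proof (cases "x = k")
    case True
    then show ?thesis using m by (simp add: bordered_def)
  next
    case False
    then have "x + 1 \<in> {1..k}" using x by auto
    moreover have "\<not> ?I (x + 1) < m"
    proof
      assume "?I (x + 1) < m"
      then have "x + 1 \<le> (GREATEST x. x \<le> k \<and> ?I x < m)"
        using \<open>x + 1 \<in> {1..k}\<close> by (intro Greatest_le_nat[of _ _ k]) auto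
      then have "x + 1 \<le> x"
        by (simp only: x_def[symmetric])
      then show False by simp
    qed
    ultimately show ?thesis using no_pos[of "x + 1"] by (auto simp: bordered_def)
  qed
  then show False using empty[of x m] x lt \<tau>m by simp
qed

text \<open>Unit steps count up from \<open>0\<close> as far as index \<open>i\<close> and down from
  \<open>n + 1\<close> as far as index \<open>i + 1\<close>; step \<open>i\<close> absorbs the
  remaining gap.\<close>

lemma consecutive_steps_eq:
  fixes v :: "nat \<Rightarrow> nat"
  assumes "v 0 = 0" "v (k + 1) = n + 1" "k \<le> n" "j \<in> {1..k}"
    and step: "\<And>y. y \<le> k \<Longrightarrow> y \<noteq> i \<Longrightarrow> v (y + 1) = v y + 1"
  shows "v j = (if j \<le> i then j else n - k + j)"
proof (cases "j \<le> i")
  case True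
  have "j \<le> i \<Longrightarrow> j \<le> k \<Longrightarrow> v j = j" for j
    by (induction j) (use assms(1) step in auto)
  then show ?thesis using True assms(4) by auto
next
  case False
  \<comment> \<open>Downward induction, starting from
    \<open>n + 1 = n - k + (k + 1)\<close>.\<close>
  have "i < j \<Longrightarrow> v j = n - k + j" if "j \<le> k + 1" for j
    using that
  proof (induction rule: inc_induct)
    case base
    then show ?case using assms(2,3) by simp
  next
    case (step y)
    then show ?case using assms(5)[of y] by simp
  qed
  then show ?thesis using False assms(4) by auto
qed

text \<open>The shaded rows force \<open>w j\<close> to be the \<open>j\<close>-th smallest letter
  of an occurrence, so its \<open>a\<close>-th letter is \<open>w (\<pi> a)\<close>. The only
  candidate positions are thus \<open>inv \<tau> (w (\<pi> a))\<close>, and what remains to be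
  required is that they increase.\<close>

lemma contains_mesh_unshaded_row_iff:
  assumes \<pi>: "\<pi> permutes {1..k}" and i: "i \<le> k" and "k \<le> n" and \<tau>: "\<tau> permutes {1..n}"
  defines "w \<equiv> \<lambda>j. if j \<le> i then j else n - k + j"
  shows "contains_mesh k (\<pi>, {0..k} \<times> ({0..k} - {i})) n \<tau> \<longleftrightarrow>
    strict_mono_on {1..k} (inv \<tau> \<circ> w \<circ> \<pi>)"
proof
  assume "contains_mesh k (\<pi>, {0..k} \<times> ({0..k} - {i})) n \<tau>"
  then obtain pos where "mesh_occurrence k (\<pi>, {0..k} \<times> ({0..k} - {i})) n \<tau> pos"
    by (auto simp: contains_mesh_def)
  then have pos: "pos ` {1..k} \<subseteq> {1..n}" "strict_mono_on {1..k} pos"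
    and ord: "\<And>a b. a \<in> {1..k} \<Longrightarrow> b \<in> {1..k} \<Longrightarrow> \<tau> (pos a) < \<tau> (pos b) \<longleftrightarrow> \<pi> a < \<pi> b"
    and shaded: "\<And>x y m. x \<le> k \<Longrightarrow> y \<le> k \<Longrightarrow> y \<noteq> i \<Longrightarrow> bordered k n pos x < m \<Longrightarrow>
      m < bordered k n pos (x + 1) \<Longrightarrow>
      bordered k n (kth_smallest (\<tau> ` pos ` {1..k})) y < \<tau> m \<Longrightarrow>
      \<tau> m < bordered k n (kth_smallest (\<tau> ` pos ` {1..k})) (y + 1) \<Longrightarrow> False"
    unfolding mesh_occurrence_def Let_def by auto
  \<comment> \<open>\<open>u j\<close> is the letter in the role of the pattern value
    \<open>j\<close>; indexing by value instead of position makes it increasing, hence the sorted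
    enumeration of the letters.\<close>
  define u where "u = \<tau> \<circ> pos \<circ> inv \<pi>"
  define v where "v = bordered k n (kth_smallest (\<tau> ` pos ` {1..k}))"
  have inv\<pi>: "inv \<pi> j \<in> {1..k} \<longleftrightarrow> j \<in> {1..k}" for j
    using permutes_in_image[OF permutes_inv[OF \<pi>]] .
  have mono_u: "strict_mono_on {1..k} u"
    using ord inv\<pi> \<pi> by (intro strict_mono_onI) (auto simp: u_def permutes_inverses)
  have "u ` {1..k} = \<tau> ` pos ` {1..k}"
    unfolding u_def image_comp[symmetric] permutes_image[OF permutes_inv[OF \<pi>]] ..
  then have vu: "v j = u j" if "j \<in> {1..k}" for j
    using kth_smallest_strict_mono_on[OF mono_u that] that by (simp add: v_def bordered_def)
  have u_range: "u j \<in> {1..n}" if "j \<in> {1..k}" for j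
  proof -
    have "pos (inv \<pi> j) \<in> {1..n}" using inv\<pi> pos(1) that by blast
    then show ?thesis using permutes_in_image[OF \<tau>] by (simp add: u_def)
  qed
  have v0: "v 0 = 0" and vk: "v (k + 1) = n + 1"
    by (simp_all add: v_def bordered_def)
  have "strict_mono_on {0..k+1} v"
  proof (rule strict_mono_onI)
    fix r s assume rs: "r \<in> {0..k+1}" "s \<in> {0..k+1}" "r < s"
    consider "r = 0" "s = k + 1" | "r = 0" "s \<in> {1..k}" | "r \<in> {1..k}" "s = k + 1"
      | "r \<in> {1..k}" "s \<in> {1..k}"
      using rs by fastforce
    then show "v r < v s"
    proof cases
      case 1 then show ?thesis using v0 vk by simp
    next
      case 2 then show ?thesis using v0 vu u_range[of s] by simp
    next
      case 3 then show ?thesis using vk vu u_range[of r] by simp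
    next
      case 4 then show ?thesis using vu mono_u rs by (simp add: strict_mono_on_def)
    qed
  qed
  moreover have "\<exists>b\<in>{1..k}. \<tau> (pos a) = v b" if "a \<in> {1..k}" for a
  proof
    show "\<pi> a \<in> {1..k}" using permutes_in_image[OF \<pi>] that by blast
    then show "\<tau> (pos a) = v (\<pi> a)" using vu \<pi> by (simp add: u_def permutes_inverses)
  qed
  ultimately have "v (y + 1) = v y + 1" if "y \<le> k" "y \<noteq> i" for y
    using shaded that by (intro shaded_row_consecutive_values[OF \<tau> pos(1) v_def]) (auto simp: v_def)
  then have "v j = w j" if "j \<in> {1..k}" for j
    unfolding w_def using consecutive_steps_eq[OF v0 vk \<open>k \<le> n\<close> that] by blast
  \<comment> \<open>Here \<open>\<tau> (pos a) = u (\<pi> a) = w (\<pi> a)\<close>, so applying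
    \<open>inv \<tau>\<close> recovers the position.\<close>
  then have "(inv \<tau> \<circ> w \<circ> \<pi>) a = pos a" if "a \<in> {1..k}" for a
    using vu permutes_in_image[OF \<pi>] that \<pi> \<tau>
    by (metis comp_apply u_def permutes_inverses(2))
  then show "strict_mono_on {1..k} (inv \<tau> \<circ> w \<circ> \<pi>)"
    using pos(2) by (auto simp: strict_mono_on_def simp del: comp_apply)
next
  assume mono: "strict_mono_on {1..k} (inv \<tau> \<circ> w \<circ> \<pi>)"
  define pos where "pos = inv \<tau> \<circ> w \<circ> \<pi>"
  have \<tau>pos: "\<tau> (pos j) = w (\<pi> j)" for j
    using \<tau> by (simp add: pos_def permutes_inverses)
  have \<pi>_in: "\<pi> j \<in> {1..k}" if "j \<in> {1..k}" for j
    using permutes_in_image[OF \<pi>] that by blast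
  have mono_w: "strict_mono w"
    by (rule strict_monoI) (auto simp: w_def)
  have w_in: "w j \<in> {1..n}" if "j \<in> {1..k}" for j
    using that \<open>k \<le> n\<close> by (auto simp: w_def)
  have "pos j \<in> {1..n}" if "j \<in> {1..k}" for j
    using w_in[OF \<pi>_in[OF that]] permutes_in_image[OF permutes_inv[OF \<tau>]] by (simp add: pos_def)
  moreover have "\<tau> (pos a) < \<tau> (pos b) \<longleftrightarrow> \<pi> a < \<pi> b" for a b
    using mono_w by (simp add: \<tau>pos strict_mono_less)
  moreover have "\<tau> ` pos ` {1..k} = w ` {1..k}"
    using permutes_image[OF \<pi>] by (metis (no_types, lifting) \<tau>pos image_cong image_image)
  then have ks: "kth_smallest (\<tau> ` pos ` {1..k}) j = w j" if "j \<in> {1..k}" for j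
    using kth_smallest_strict_mono_on[of k w j] mono_w that by (simp add: strict_mono_on_def)
  \<comment> \<open>The values bounding a shaded row are consecutive integers, so no letter fits
    between them and all its boxes are empty.\<close>
  have "bordered k n (kth_smallest (\<tau> ` pos ` {1..k})) (y + 1) =
      bordered k n (kth_smallest (\<tau> ` pos ` {1..k})) y + 1" if "y \<le> k" "y \<noteq> i" for y
    using that i \<open>k \<le> n\<close> ks[of y] ks[of "y + 1"] by (auto simp: bordered_def w_def)
  ultimately have "mesh_occurrence k (\<pi>, {0..k} \<times> ({0..k} - {i})) n \<tau> pos"
    using mono unfolding mesh_occurrence_def Let_def pos_def[symmetric] by auto
  then show "contains_mesh k (\<pi>, {0..k} \<times> ({0..k} - {i})) n \<tau>"
    by (auto simp: contains_mesh_def)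
qed

theorem theorem3p2:
  fixes k i n :: nat and \<pi> :: "nat \<Rightarrow> nat" and R :: "(nat \<times> nat) set"
  assumes "k \<ge> 1"
    and "\<pi> permutes {1..k}"
    and "i \<in> {0..k}"
    and "R = {0..k} \<times> ({0..k} - {i})"
    and "n \<ge> k"
  shows "real (s_plus k (\<pi>, R) n) = fact n / fact k
       \<and> real (s_plus k (\<pi>, R) n) / fact n = 1 / fact k"
proof -
  define w where "w = (\<lambda>j. if j \<le> i then j else n - k + j)"
  have "{\<tau>. \<tau> permutes {1..n} \<and> contains_mesh k (\<pi>, R) n \<tau>} =
      {\<tau>. \<tau> permutes {1..n} \<and> strict_mono_on {1..k} (inv \<tau> \<circ> w \<circ> \<pi>)}"
    using contains_mesh_unshaded_row_iff[of \<pi> k i n] assms unfolding w_def by auto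
  \<comment> \<open>As \<open>k \<le> n\<close>, the block of small values \<open>1\<close> to
    \<open>i\<close> lies below the block \<open>n - k + i + 1\<close> to \<open>n\<close>.\<close>
  moreover have "inj_on w {1..k}" "w ` {1..k} \<subseteq> {1..n}"
    using assms by (auto simp: inj_on_def w_def split: if_splits)
  ultimately have "fact k * s_plus k (\<pi>, R) n = fact n"
    using card_permutes_strict_mono_on_inv[of w k n \<pi>] assms(2) by (simp add: s_plus_def)
  then have "fact k * real (s_plus k (\<pi>, R) n) = fact n"
    by (metis of_nat_fact of_nat_mult)
  then show ?thesis
    by (simp add: field_simps)
qed

end
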